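(* Let $X$ be a Banach space over $\mathbb{K}\in\{\mathbb{R},\mathbb{C}\}$, let $\Lambda$ be a nonempty set, and let $X_\lambda$, $\lambda\in\Lambda$, be closed linear subspaces of $X$. Then the family $(X_\lambda)_{\lambda\in\Lambda}$ is an absolutely representing family of subspaces (ARFS) in $X$ if and only if there exists $\varepsilon>0$ such that $$\sup_{\lambda\in\Lambda}\|\varphi\upharpoonright_{X_\lambda}\|\geqslant\varepsilon\|\varphi\|\quad\text{for every }\varphi\in X^*.$$
   Context: The family $(X_\lambda)_{\lambda\in\Lambda}$ of closed linear subspaces of $X$ is called an absolutely representing family of subspaces (ARFS) in $X$ if for every $x\in X$ there exist $x_\lambda\in X_\lambda$, $\lambda\in\Lambda$, such that $\sum_{\lambda\in\Lambda}\|x_\lambda\|<\infty$ and $x=\sum_{\lambda\in\Lambda}x_\lambda$. $X^*$ is the space of continuous linear functionals $X\to\mathbb{K}$ with the operator norm, and $\|\varphi\upharpoonright_{Y}\|$ is the norm of the restriction of $\varphi$ to the subspace $Y$, as an element of $Y^*$ (equal to $0$ if $Y=\{0\}$). *)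

theory Defs
  imports "HOL-Analysis.Analysis"
begin

text \<open>
  The class \<^class>\<open>banach\<close> only provides real scalars, so the scalar multiplication of a Banach
  space over the scalar field is passed explicitly. A complex Banach space is a \<^class>\<open>banach\<close>
  type with a scalar multiplication by complex numbers that extends the real one (every complex
  Banach space arises in this way, by restriction of scalars).
\<close>

locale banach_space_over = vector_space scale
  for scale :: "'k::real_normed_field \<Rightarrow> 'a::banach \<Rightarrow> 'a" +
  assumes norm_scale: "norm (scale c x) = norm c * norm x"
    and scale_of_real: "scale (of_real r) x = r *\<^sub>R x"

lemma banach_space_over_scaleR: "banach_space_over (scaleR :: real \<Rightarrow> 'a::banach \<Rightarrow> 'a)"
  by unfold_locales (auto simp: algebra_simps)

lemma banach_space_over_complex: "banach_space_over ((*) :: complex \<Rightarrow> complex \<Rightarrow> complex)"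
  by unfold_locales (auto simp: algebra_simps norm_mult scaleR_conv_of_real)

definition dual_space :: "('k::real_normed_field \<Rightarrow> 'a::banach \<Rightarrow> 'a) \<Rightarrow> ('a \<Rightarrow> 'k) set" where
  "dual_space sc = {\<phi>. Vector_Spaces.linear sc (*) \<phi> \<and> continuous_on UNIV \<phi>}"

text \<open>
  Norm of the restriction of a functional to a subspace, in the style of \<^const>\<open>onorm\<close> (to which it
  reduces when \<open>S\<close> is the whole space). As \<open>0 / 0 = 0\<close>, the point \<open>0\<close> contributes the value \<open>0\<close>,
  and the norm is \<open>0\<close> for \<open>S = {0}\<close>.
\<close>

definition onorm_on :: "'a::real_normed_vector set \<Rightarrow> ('a \<Rightarrow> 'b::real_normed_vector) \<Rightarrow> real" where
  "onorm_on S \<phi> = (SUP x\<in>S. norm (\<phi> x) / norm x)"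

lemma onorm_on_UNIV: "onorm_on UNIV \<phi> = onorm \<phi>"
  by (simp add: onorm_on_def onorm_def)

definition absolutely_representing :: "'i set \<Rightarrow> ('i \<Rightarrow> 'a::banach set) \<Rightarrow> bool" where
  "absolutely_representing \<Lambda> X \<longleftrightarrow>
     (\<forall>x. \<exists>y. (\<forall>l\<in>\<Lambda>. y l \<in> X l) \<and> (\<lambda>l. norm (y l)) summable_on \<Lambda> \<and> (y has_sum x) \<Lambda>)"

end

theory Submission
  imports Defs
begin

text \<open>
  Suppose that the family is representing. The set of \<open>x\<close> with \<open>\<bar>\<phi> x\<bar> \<le> n k\<close> for all \<open>\<phi>\<close> and \<open>k\<close>
  such that \<open>\<phi>\<close> has norm at most \<open>k\<close> on every member of the family is closed, and these sets cover
  the space as \<open>n\<close> varies. By Baire's theorem one of them contains a ball, which gives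
  \<open>\<parallel>\<phi>\<parallel> \<le> C sup\<^sub>\<lambda> \<parallel>\<phi>|X\<^sub>\<lambda>\<parallel>\<close>.

  Conversely, let \<open>p x\<close> be the infimum of \<open>\<Sum>\<parallel>y\<^sub>\<lambda>\<parallel> + K \<parallel>x - \<Sum>y\<^sub>\<lambda>\<parallel>\<close> over the absolutely convergent
  families \<open>y\<close>, where \<open>K = 4 / \<epsilon>\<close>. A functional dominated by the seminorm \<open>p\<close> has norm at most \<open>1\<close> on
  every member, hence norm at most \<open>1 / \<epsilon>\<close>, so \<open>p x \<le> \<parallel>x\<parallel> / \<epsilon>\<close> by the Hahn--Banach theorem. Thus
  every \<open>x\<close> is within \<open>\<parallel>x\<parallel> / 2\<close> of an element with a representation of cost at most \<open>2 \<parallel>x\<parallel> / \<epsilon>\<close>,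
  and iterating on the remainder represents \<open>x\<close> itself.
\<close>

section \<open>The Hahn--Banach theorem\<close>

text \<open>Only inequalities are asked for, since these are what one can check for an infimum.
  Scaling by \<open>1/t\<close> upgrades the second clause to equality, and then
  \<open>p 0 = 0\<close> follows.\<close>

definition sublinear :: "('a::real_vector \<Rightarrow> real) \<Rightarrow> bool" where
  "sublinear p \<longleftrightarrow> (\<forall>x y. p (x + y) \<le> p x + p y) \<and> (\<forall>t>0. \<forall>x. p (t *\<^sub>R x) \<le> t * p x) \<and> 0 \<le> p 0"

lemma sublinearI:
  assumes "\<And>x y. p (x + y) \<le> p x + p y" "\<And>t x. t > 0 \<Longrightarrow> p (t *\<^sub>R x) \<le> t * p x" "0 \<le> p 0"
  shows "sublinear p"
  using assms by (simp add: sublinear_def)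

lemma sublinear_add: "sublinear p \<Longrightarrow> p (x + y) \<le> p x + p y"
  by (simp add: sublinear_def)

lemma sublinear_scale_le: "sublinear p \<Longrightarrow> t > 0 \<Longrightarrow> p (t *\<^sub>R x) \<le> t * p x"
  by (simp add: sublinear_def)

lemma sublinear_scale:
  assumes "sublinear p" "t > 0"
  shows "p (t *\<^sub>R x) = t * p x"
proof (rule antisym)
  show "p (t *\<^sub>R x) \<le> t * p x"
    using assms by (rule sublinear_scale_le)
  have "p ((1/t) *\<^sub>R (t *\<^sub>R x)) \<le> (1/t) * p (t *\<^sub>R x)"
    using assms by (intro sublinear_scale_le) auto
  with assms(2) show "t * p x \<le> p (t *\<^sub>R x)"
    by (simp add: field_simps)
qed

lemma sublinear_zero: "sublinear p \<Longrightarrow> p 0 = 0"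
  using sublinear_scale[of p 2 0] by simp

lemma sublinear_minus: "sublinear p \<Longrightarrow> 0 \<le> p x + p (- x)"
  using sublinear_add[of p x "- x"] by (simp add: sublinear_zero)

text \<open>Supplies the bounds for Zorn's lemma. The infima are finite because
  \<open>q x \<ge> - q (- x) \<ge> - p (- x)\<close>. Subadditivity uses the chain property: two
  members \<open>q\<close> and \<open>r\<close> can both be replaced by the smaller one.\<close>

lemma sublinear_chain_Inf:
  assumes ne: "C \<noteq> {}" and sub: "\<And>q. q \<in> C \<Longrightarrow> sublinear q \<and> q \<le> p"
    and chain: "\<And>q r. q \<in> C \<Longrightarrow> r \<in> C \<Longrightarrow> q \<le> r \<or> r \<le> q"
  shows "sublinear (\<lambda>x. INF q\<in>C. q x)" and "\<And>q x. q \<in> C \<Longrightarrow> (INF q\<in>C. q x) \<le> q x"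
proof -
  have bdd: "bdd_below ((\<lambda>q. q x) ` C)" for x
  proof (rule bdd_belowI2)
    fix q assume "q \<in> C"
    then show "- p (- x) \<le> q x"
      using sub[of q] sublinear_minus[of q x] le_funD[of q p "- x"] by auto
  qed
  show low: "(INF q\<in>C. q x) \<le> q x" if "q \<in> C" for q x
    using bdd that by (rule cINF_lower)
  show "sublinear (\<lambda>x. INF q\<in>C. q x)"
  proof (rule sublinearI)
    fix x y
    have "(INF q\<in>C. q (x + y)) - q x \<le> (INF r\<in>C. r y)" if q: "q \<in> C" for q
    proof (rule cINF_greatest[OF ne])
      fix r assume r: "r \<in> C"
      obtain s where s: "s \<in> C" "s \<le> q" "s \<le> r"
        using chain[OF q r] q r by blast
      have "(INF q\<in>C. q (x + y)) \<le> s x + s y"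
        using low[OF s(1), of "x + y"] sublinear_add[of s x y] sub[OF s(1)] by linarith
      with le_funD[OF s(2), of x] le_funD[OF s(3), of y]
      show "(INF q\<in>C. q (x + y)) - q x \<le> r y" by linarith
    qed
    then have "(INF q\<in>C. q (x + y)) - (INF r\<in>C. r y) \<le> (INF q\<in>C. q x)"
      by (intro cINF_greatest[OF ne]) (simp add: algebra_simps)
    then show "(INF q\<in>C. q (x + y)) \<le> (INF q\<in>C. q x) + (INF q\<in>C. q y)" by linarith
  next
    fix t :: real and x assume t: "t > 0"
    have "(INF q\<in>C. q (t *\<^sub>R x)) / t \<le> (INF q\<in>C. q x)"
    proof (rule cINF_greatest[OF ne])
      fix q assume "q \<in> C"
      then show "(INF q\<in>C. q (t *\<^sub>R x)) / t \<le> q x"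
        using low[of q "t *\<^sub>R x"] sublinear_scale[of q t x] sub t by (simp add: field_simps)
    qed
    with t show "(INF q\<in>C. q (t *\<^sub>R x)) \<le> t * (INF q\<in>C. q x)" by (simp add: field_simps)
  next
    show "0 \<le> (INF q\<in>C. q 0)"
      by (rule cINF_greatest[OF ne]) (use sub sublinear_zero in fastforce)
  qed
qed

lemma minimal_sublinear_exists:
  fixes p :: "'a::real_vector \<Rightarrow> real"
  assumes "sublinear p"
  obtains m where "sublinear m" "m \<le> p" "\<And>q. sublinear q \<Longrightarrow> q \<le> m \<Longrightarrow> q = m"
proof -
  \<comment> \<open>Zorn's lemma produces a maximal element, so the pointwise order is
    reversed.\<close>
  let ?A = "{q. sublinear q \<and> q \<le> p}" and ?P = "\<lambda>q r :: 'a \<Rightarrow> real. r \<le> q"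
  have "\<exists>m\<in>?A. \<forall>q\<in>?A. ?P m q \<longrightarrow> q = m"
  proof (rule predicate_Zorn)
    show "partial_order_on ?A (relation_of ?P ?A)"
      by (rule partial_order_on_relation_ofI) auto
    fix C assume C: "C \<in> Chains (relation_of ?P ?A)"
    show "\<exists>u\<in>?A. \<forall>q\<in>C. ?P q u"
    \<comment> \<open>The empty chain is bounded by \<open>p\<close> itself, because an
      \<open>INF\<close> over no functions carries no information.\<close>
    proof (cases "C = {}")
      case True
      with assms show ?thesis by auto
    next
      case False
      have sub: "sublinear q \<and> q \<le> p" if "q \<in> C" for q
        using Chains_relation_of[OF C] that by blast
      have chain: "q \<le> r \<or> r \<le> q" if "q \<in> C" "r \<in> C" for q r
        using C that by (auto simp: Chains_def relation_of_def)
      have "(\<lambda>x. INF q\<in>C. q x) \<le> q" if "q \<in> C" for q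
        using sublinear_chain_Inf(2)[of C p q] False sub chain that by (simp add: le_fun_def)
      moreover from this False sub have "(\<lambda>x. INF q\<in>C. q x) \<le> p"
        by (meson all_not_in_conv order_trans)
      moreover have "sublinear (\<lambda>x. INF q\<in>C. q x)"
        using False sub chain by (rule sublinear_chain_Inf(1))
      ultimately show ?thesis by blast
    qed
  qed
  then show ?thesis
    using that order_trans by blast
qed

text \<open>Lowers \<open>p\<close> along the ray spanned by \<open>a\<close>: take the infimum over
  \<open>t \<ge> 0\<close> of \<open>p (x + t *\<^sub>R a) - t * p a\<close>. The choice
  \<open>t = 0\<close> gives \<open>q \<le> p\<close>, and \<open>t = 1\<close> at
  \<open>- a\<close> gives the last claim.\<close>

lemma sublinear_shift:
  assumes p: "sublinear p"
  shows "\<exists>q. sublinear q \<and> q \<le> p \<and> q (- a) \<le> - p a"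
proof -
  define q where "q x = (INF t\<in>{0..}. p (x + t *\<^sub>R a) - t * p a)" for x
  have ta: "p (t *\<^sub>R a) = t * p a" if "t \<ge> 0" for t
    using that sublinear_scale[OF p, of t a] sublinear_zero[OF p] by (cases "t = 0") auto
  have bdd: "bdd_below ((\<lambda>t. p (x + t *\<^sub>R a) - t * p a) ` {0..})" for x
  proof (rule bdd_belowI2)
    fix t :: real assume "t \<in> {0..}"
    then show "- p (- x) \<le> p (x + t *\<^sub>R a) - t * p a"
      using sublinear_add[OF p, of "x + t *\<^sub>R a" "- x"] ta[of t] by simp
  qed
  have low: "q x \<le> p (x + t *\<^sub>R a) - t * p a" if "t \<ge> 0" for x t
    unfolding q_def using bdd by (rule cINF_lower) (use that in simp)
  have great: "c \<le> q x" if "\<And>t. t \<ge> 0 \<Longrightarrow> c \<le> p (x + t *\<^sub>R a) - t * p a" for c x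
    unfolding q_def by (rule cINF_greatest) (use that in auto)
  have "sublinear q"
  proof (rule sublinearI)
    fix x y
    have "q (x + y) - (p (x + t *\<^sub>R a) - t * p a) \<le> q y" if t: "t \<ge> 0" for t
    proof (rule great)
      fix s :: real assume s: "s \<ge> 0"
      have "q (x + y) \<le> p ((x + t *\<^sub>R a) + (y + s *\<^sub>R a)) - (t + s) * p a"
        using low[of "t + s" "x + y"] s t by (simp add: algebra_simps)
      also have "\<dots> \<le> p (x + t *\<^sub>R a) + p (y + s *\<^sub>R a) - (t + s) * p a"
        using sublinear_add[OF p] by simp
      finally show "q (x + y) - (p (x + t *\<^sub>R a) - t * p a) \<le> p (y + s *\<^sub>R a) - s * p a"
        by (simp add: algebra_simps)
    qed
    then have "q (x + y) - q y \<le> q x"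
      by (intro great) (simp add: algebra_simps)
    then show "q (x + y) \<le> q x + q y" by simp
  next
    fix s :: real and x assume s: "s > 0"
    have "q (s *\<^sub>R x) / s \<le> q x"
    proof (rule great)
      fix t :: real assume t: "t \<ge> 0"
      have "q (s *\<^sub>R x) \<le> p (s *\<^sub>R (x + t *\<^sub>R a)) - s * t * p a"
        using low[of "s * t" "s *\<^sub>R x"] s t by (simp add: scaleR_add_right)
      then show "q (s *\<^sub>R x) / s \<le> p (x + t *\<^sub>R a) - t * p a"
        using s unfolding sublinear_scale[OF p s] by (simp add: field_simps)
    qed
    with s show "q (s *\<^sub>R x) \<le> s * q x" by (simp add: field_simps)
  next
    show "0 \<le> q 0" by (rule great) (use ta in simp)
  qed
  moreover have "q \<le> p"
    using low[of 0] by (simp add: le_fun_def)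
  moreover have "q (- a) \<le> - p a"
    using low[of 1 "- a"] sublinear_zero[OF p] by simp
  ultimately show ?thesis by blast
qed

text \<open>By \<open>sublinear_shift\<close>, minimality forces \<open>m\<close> to be odd, hence additive.\<close>

lemma minimal_sublinear_linear:
  assumes m: "sublinear m" and min: "\<And>q. sublinear q \<Longrightarrow> q \<le> m \<Longrightarrow> q = m"
  shows "linear m"
proof -
  have minus: "m (- x) = - m x" for x
    using sublinear_shift[OF m, of x] min sublinear_minus[OF m, of x] by fastforce
  have add: "m (x + y) = m x + m y" for x y
    using sublinear_add[OF m, of x y] sublinear_add[OF m, of "- x" "- y"] minus[of "x + y"]
    by (simp add: minus)
  have "m (t *\<^sub>R x) = t * m x" for t x
  proof (cases t "0 :: real" rule: linorder_cases)
    case less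
    with sublinear_scale[OF m, of "- t" x] show ?thesis by (simp add: minus)
  qed (use sublinear_scale[OF m, of t x] sublinear_zero[OF m] in auto)
  with add show ?thesis by (simp add: linear_iff)
qed

text \<open>Shifting before minimising makes \<open>f\<close> touch \<open>p\<close> at
  \<open>a\<close>: any linear \<open>f\<close> below the shifted \<open>q\<close> has
  \<open>- f a = f (- a) \<le> - p a\<close>, hence \<open>f a \<ge> p a\<close>.\<close>

theorem Hahn_Banach_sublinear:
  assumes p: "sublinear p"
  obtains f where "linear f" "f \<le> p" "f a = p a"
proof -
  obtain q where q: "sublinear q" "q \<le> p" "q (- a) \<le> - p a"
    using sublinear_shift[OF p] by blast
  obtain f where f: "sublinear f" "f \<le> q" "\<And>r. sublinear r \<Longrightarrow> r \<le> f \<Longrightarrow> r = f"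
    using minimal_sublinear_exists[OF q(1)] by blast
  have lin: "linear f"
    using f(1,3) by (rule minimal_sublinear_linear)
  have le: "f \<le> p"
    using f(2) q(2) by (rule order_trans)
  have "f (- a) \<le> - p a"
    using q(3) le_funD[OF f(2), of "- a"] by simp
  then have "f a = p a"
    using linear_neg[OF lin, of a] le_funD[OF le, of a] by simp
  with lin le that show ?thesis by blast
qed

section \<open>Absolutely convergent representations\<close>

text \<open>Allowing a majorant \<open>w\<close> of the norms, instead of the norms themselves, makes the relation
  stable under sums.\<close>

definition representable :: "'i set \<Rightarrow> ('i \<Rightarrow> 'a::banach set) \<Rightarrow> 'a \<Rightarrow> real \<Rightarrow> bool" where
  "representable \<Lambda> X u c \<longleftrightarrow>
     (\<exists>y w. (\<forall>l\<in>\<Lambda>. y l \<in> X l \<and> norm (y l) \<le> w l) \<and> (y has_sum u) \<Lambda> \<and> (w has_sum c) \<Lambda>)"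

lemma absolutely_representing_iff_representable:
  "absolutely_representing \<Lambda> X \<longleftrightarrow> (\<forall>u. \<exists>c. representable \<Lambda> X u c)"
proof (intro iffI allI)
  fix u assume "absolutely_representing \<Lambda> X"
  then obtain y where "\<forall>l\<in>\<Lambda>. y l \<in> X l" "(\<lambda>l. norm (y l)) summable_on \<Lambda>" "(y has_sum u) \<Lambda>"
    unfolding absolutely_representing_def by blast
  then show "\<exists>c. representable \<Lambda> X u c"
    unfolding representable_def summable_on_def by (metis order_refl)
next
  assume *: "\<forall>u. \<exists>c. representable \<Lambda> X u c"
  show "absolutely_representing \<Lambda> X"
    unfolding absolutely_representing_def
  proof
    fix u
    obtain y w c where y: "\<forall>l\<in>\<Lambda>. y l \<in> X l \<and> norm (y l) \<le> w l" "(y has_sum u) \<Lambda>"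
      and w: "(w has_sum c) \<Lambda>"
      using * unfolding representable_def by blast
    have "(\<lambda>l. norm (y l)) summable_on \<Lambda>"
      by (rule Infinite_Sum.abs_summable_on_comparison_test'[OF has_sum_imp_summable[OF w]]) (use y in simp)
    with y show "\<exists>y. (\<forall>l\<in>\<Lambda>. y l \<in> X l) \<and> (\<lambda>l. norm (y l)) summable_on \<Lambda> \<and> (y has_sum u) \<Lambda>"
      by blast
  qed
qed

lemma representable_nonneg: "representable \<Lambda> X u c \<Longrightarrow> 0 \<le> c"
  unfolding representable_def by (meson has_sum_nonneg norm_ge_zero order_trans)

text \<open>The bounds on the members are summed against the majorant \<open>w\<close>. It serves
  both for functionals and, with the identity and \<open>k = 1\<close>, for the estimate of
  \<open>u\<close> itself.\<close>

lemma norm_le_of_representable: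
  assumes "bounded_linear \<phi>" "representable \<Lambda> X u c"
    and le: "\<And>l x. l \<in> \<Lambda> \<Longrightarrow> x \<in> X l \<Longrightarrow> norm (\<phi> x) \<le> k * norm x" and "0 \<le> k"
  shows "norm (\<phi> u) \<le> k * c"
proof -
  obtain y w where y: "\<And>l. l \<in> \<Lambda> \<Longrightarrow> y l \<in> X l \<and> norm (y l) \<le> w l"
    and sums: "(y has_sum u) \<Lambda>" "(w has_sum c) \<Lambda>"
    using assms(2) unfolding representable_def by blast
  show ?thesis
  proof (rule norm_infsum_le)
    show "((\<lambda>l. \<phi> (y l)) has_sum \<phi> u) \<Lambda>"
      using assms(1) sums(1) by (rule has_sum_bounded_linear)
    show "((\<lambda>l. k * w l) has_sum k * c) \<Lambda>"
      using sums(2) by (rule has_sum_cmult_right)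
  qed (meson y le \<open>0 \<le> k\<close> mult_left_mono order_trans)
qed

lemma norm_le_of_representable': "representable \<Lambda> X u c \<Longrightarrow> norm u \<le> c"
  using norm_le_of_representable[OF bounded_linear_ident, of \<Lambda> X u c 1] by simp

context
  fixes \<Lambda> :: "'i set" and X :: "'i \<Rightarrow> 'a::banach set"
  assumes subspaces: "\<forall>l\<in>\<Lambda>. subspace (X l)"
begin

lemma representable_zero: "representable \<Lambda> X 0 0"
  unfolding representable_def
  by (intro exI[of _ "\<lambda>_. 0"]) (use subspaces in \<open>auto simp: subspace_0\<close>)

lemma representable_add:
  assumes "representable \<Lambda> X u c" "representable \<Lambda> X v d"
  shows "representable \<Lambda> X (u + v) (c + d)"
proof -
  obtain y w where y: "\<forall>l\<in>\<Lambda>. y l \<in> X l \<and> norm (y l) \<le> w l" "(y has_sum u) \<Lambda>" "(w has_sum c) \<Lambda>"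
    using assms(1) unfolding representable_def by blast
  obtain y' w' where y': "\<forall>l\<in>\<Lambda>. y' l \<in> X l \<and> norm (y' l) \<le> w' l" "(y' has_sum v) \<Lambda>"
      "(w' has_sum d) \<Lambda>"
    using assms(2) unfolding representable_def by blast
  show ?thesis
    unfolding representable_def
    by (intro exI[of _ "\<lambda>l. y l + y' l"] exI[of _ "\<lambda>l. w l + w' l"] conjI has_sum_add ballI)
      (use y y' subspaces in \<open>auto intro!: subspace_add norm_triangle_le add_mono\<close>)
qed

lemma representable_scale:
  assumes "representable \<Lambda> X u c" "0 \<le> t"
  shows "representable \<Lambda> X (t *\<^sub>R u) (t * c)"
proof -
  obtain y w where y: "\<forall>l\<in>\<Lambda>. y l \<in> X l \<and> norm (y l) \<le> w l" "(y has_sum u) \<Lambda>" "(w has_sum c) \<Lambda>"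
    using assms(1) unfolding representable_def by blast
  show ?thesis
    unfolding representable_def
    by (intro exI[of _ "\<lambda>l. t *\<^sub>R y l"] exI[of _ "\<lambda>l. t * w l"] conjI has_sum_scaleR
        has_sum_cmult_right ballI)
      (use y assms(2) subspaces in \<open>auto intro!: subspace_scale mult_left_mono\<close>)
qed

lemma representable_member:
  assumes "l \<in> \<Lambda>" "x \<in> X l"
  shows "representable \<Lambda> X x (norm x)"
  unfolding representable_def
proof (intro exI conjI ballI)
  show "((\<lambda>i. if i = l then x else 0) has_sum x) \<Lambda>"
    by (rule has_sum_finite_neutralI[of "{l}"]) (use assms in auto)
  show "((\<lambda>i. if i = l then norm x else 0) has_sum norm x) \<Lambda>"
    by (rule has_sum_finite_neutralI[of "{l}"]) (use assms in auto)
qed (use assms subspaces in \<open>auto simp: subspace_0\<close>)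

text \<open>Countably many representations with summable costs are merged componentwise. The member
  at \<open>l\<close> receives the series of all \<open>l\<close>-components, and its limit stays in
  \<open>X l\<close> by closedness.\<close>

lemma representable_sums:
  assumes closed: "\<And>l. l \<in> \<Lambda> \<Longrightarrow> closed (X l)"
    and repr: "\<And>n. representable \<Lambda> X (u n) (c n)" and "summable c" "u sums x"
  shows "representable \<Lambda> X x (suminf c)"
proof -
  obtain y w where yw: "\<And>n l. l \<in> \<Lambda> \<Longrightarrow> y n l \<in> X l \<and> norm (y n l) \<le> w n l"
    and y: "\<And>n. (y n has_sum u n) \<Lambda>" and w: "\<And>n. (w n has_sum c n) \<Lambda>"
    using repr unfolding representable_def by metis
  have c0: "0 \<le> c n" for n
    using repr by (rule representable_nonneg)
  have w0: "0 \<le> w n l" if "l \<in> \<Lambda>" for n l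
    using yw[OF that, of n] norm_ge_zero order_trans by blast
  have c: "(c has_sum suminf c) UNIV"
    using \<open>summable c\<close> c0 by (intro sums_nonneg_imp_has_sum summable_sums)
  have u: "(u has_sum x) UNIV"
  proof (rule norm_summable_imp_has_sum)
    show "summable (\<lambda>n. norm (u n))"
      using \<open>summable c\<close> by (rule summable_comparison_test')
        (simp add: norm_le_of_representable'[OF repr])
  qed fact
  \<comment> \<open>The nonnegative \<open>w\<close> has row sums \<open>c n\<close>, which are
    summable. Hence \<open>w\<close>, and by comparison \<open>y\<close>, is summable over the
    product, and both can be summed by columns as well as by rows.\<close>
  have sw: "(\<lambda>(n, l). w n l) summable_on UNIV \<times> \<Lambda>"
    by (rule summable_on_SigmaI[where g = c]) (use w c w0 in \<open>auto simp: summable_on_def\<close>)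
  have "(\<lambda>(n, l). y n l) abs_summable_on UNIV \<times> \<Lambda>"
    by (rule Infinite_Sum.abs_summable_on_comparison_test'[OF sw]) (use yw in auto)
  then have sy: "(\<lambda>(n, l). y n l) summable_on UNIV \<times> \<Lambda>"
    by (rule abs_summable_summable)
  have W: "((\<lambda>(l, n). w n l) has_sum suminf c) (\<Lambda> \<times> UNIV)"
    using has_sum_SigmaI[of UNIV "\<lambda>(n, l). w n l", OF _ c sw] w
    by (subst has_sum_swap) (simp add: case_prod_unfold)
  have Y: "((\<lambda>(l, n). y n l) has_sum x) (\<Lambda> \<times> UNIV)"
    using has_sum_SigmaI[of UNIV "\<lambda>(n, l). y n l", OF _ u sy] y
    by (subst has_sum_swap) (simp add: case_prod_unfold)
  have wl: "(\<lambda>n. w n l) summable_on UNIV" if "l \<in> \<Lambda>" for l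
    by (rule summable_on_SigmaD1[of "\<lambda>l n. w n l" \<Lambda>])
      (use W that in \<open>auto simp: summable_on_def\<close>)
  have yl: "(\<lambda>n. y n l) summable_on UNIV" if "l \<in> \<Lambda>" for l
    by (rule abs_summable_summable, rule Infinite_Sum.abs_summable_on_comparison_test'[OF wl[OF that]])
      (use yw[OF that] in simp)
  define g where "g l = (\<Sum>\<^sub>\<infinity>n. y n l)" for l
  define h where "h l = (\<Sum>\<^sub>\<infinity>n. w n l)" for l
  have "g l \<in> X l" if l: "l \<in> \<Lambda>" for l
  proof (rule closed_sequentially[OF closed[OF l]])
    show "(\<lambda>N. \<Sum>n<N. y n l) \<longlonglongrightarrow> g l"
      using has_sum_imp_sums[OF has_sum_infsum[OF yl[OF l]]] by (simp add: sums_def g_def)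
    show "(\<Sum>n<N. y n l) \<in> X l" for N
      using bspec[OF subspaces l] yw[OF l] by (intro subspace_sum) auto
  qed
  moreover have "norm (g l) \<le> h l" if "l \<in> \<Lambda>" for l
    unfolding g_def h_def using that yw
    by (intro norm_infsum_le[OF has_sum_infsum[OF yl] has_sum_infsum[OF wl]]) auto
  moreover have "(g has_sum x) \<Lambda>"
    by (rule has_sum_SigmaD[OF Y]) (use has_sum_infsum[OF yl] in \<open>simp add: g_def\<close>)
  moreover have "(h has_sum suminf c) \<Lambda>"
    by (rule has_sum_SigmaD[OF W]) (use has_sum_infsum[OF wl] in \<open>simp add: h_def\<close>)
  ultimately show ?thesis
    unfolding representable_def by blast
qed

end


section \<open>Representing families are norming\<close>

text \<open>Contrapositive of Baire's theorem: if all interiors were empty, so would be the interior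
  of the union, which is the whole space.\<close>

lemma Baire_countable_closed_cover:
  fixes E :: "nat \<Rightarrow> 'a::banach set"
  assumes closed: "\<And>n. closed (E n)" and cover: "(\<Union>n. E n) = UNIV"
  obtains n where "interior (E n) \<noteq> {}"
proof -
  have "completely_metrizable_space (euclidean :: 'a topology)"
    by (rule completely_metrizable_space_euclidean)
  then have "interior (\<Union> (range E)) = {}" if "\<And>n. interior (E n) = {}"
    using Baire_category_alt[of euclidean "range E"] closed that by auto
  with cover that show ?thesis by auto
qed

text \<open>Stated for any set \<open>D\<close> of bounded real-linear maps into a normed space, so
  that it applies to the real and to the complex dual alike.\<close>

lemma norming_if_absolutely_representing:
  fixes D :: "('a::banach \<Rightarrow> 'b::real_normed_vector) set"
  assumes ne: "\<Lambda> \<noteq> {}" and lin: "\<And>\<phi>. \<phi> \<in> D \<Longrightarrow> bounded_linear \<phi>"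
    and sub: "\<forall>l\<in>\<Lambda>. subspace (X l)"
    and AR: "absolutely_representing \<Lambda> X"
  shows "\<exists>\<epsilon>>0. \<forall>\<phi>\<in>D. (SUP l\<in>\<Lambda>. onorm_on (X l) \<phi>) \<ge> \<epsilon> * onorm \<phi>"
proof -
  \<comment> \<open>Letting \<open>k\<close> range over all bounds postpones the question whether
    the suprema are well behaved. The supremum itself is inserted for \<open>k\<close> only at the
    end.\<close>
  define dom where "dom \<phi> k \<longleftrightarrow> 0 \<le> k \<and> (\<forall>l\<in>\<Lambda>. \<forall>x\<in>X l. norm (\<phi> x) \<le> k * norm x)"
    for \<phi> :: "'a \<Rightarrow> 'b" and k
  define E where "E n = {x. \<forall>\<phi>\<in>D. \<forall>k. dom \<phi> k \<longrightarrow> norm (\<phi> x) \<le> real n * k}" for n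
  have "closed (E n)" for n
  proof -
    have "E n = (\<Inter>\<phi>\<in>D. \<Inter>k\<in>{k. dom \<phi> k}. {x. norm (\<phi> x) \<le> real n * k})"
      by (auto simp: E_def)
    also have "closed \<dots>"
      by (intro closed_INT ballI closed_Collect_le continuous_intros)
        (use lin linear_continuous_on in blast)+
    finally show ?thesis .
  qed
  moreover have "(\<Union>n. E n) = UNIV"
  proof -
    have "\<exists>n. x \<in> E n" for x
    proof -
      obtain c where c: "representable \<Lambda> X x c"
        using AR by (auto simp: absolutely_representing_iff_representable)
      obtain n where n: "c \<le> real n"
        using real_arch_simple by blast
      have "norm (\<phi> x) \<le> real n * k" if "\<phi> \<in> D" "dom \<phi> k" for \<phi> k
      proof -
        have "norm (\<phi> x) \<le> k * c"
          using norm_le_of_representable[OF lin[OF that(1)] c, of k] that(2) by (auto simp: dom_def)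
        also have "\<dots> \<le> real n * k"
          using n that(2) by (subst mult.commute) (simp add: dom_def mult_right_mono)
        finally show ?thesis .
      qed
      then show ?thesis by (auto simp: E_def)
    qed
    then show ?thesis by auto
  qed
  ultimately obtain n where "interior (E n) \<noteq> {}"
    by (rule Baire_countable_closed_cover)
  then obtain a r where r: "r > 0" "ball a r \<subseteq> E n"
    by (meson all_not_in_conv mem_interior)
  \<comment> \<open>The ball estimate below yields the factor \<open>4 * real n / r\<close>; adding
    \<open>1\<close> keeps \<open>C\<close> positive when \<open>n = 0\<close>, so that
    \<open>1 / C\<close> can serve as \<epsilon>.\<close>
  define C where "C = 4 * real n / r + 1"
  have C: "C > 0"
    using r by (simp add: C_def add_nonneg_pos)
  have bound: "norm (\<phi> x) \<le> C * k * norm x" if "\<phi> \<in> D" "dom \<phi> k" for \<phi> k x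
  proof (cases "x = 0")
    case True
    then show ?thesis using linear_0[OF bounded_linear.linear[OF lin[OF that(1)]]] by simp
  next
    case False
    interpret bounded_linear \<phi> using lin that(1) .
    \<comment> \<open>\<open>z\<close> is \<open>x\<close> rescaled to norm \<open>r / 2\<close>.
      Both \<open>a\<close> and \<open>a + z\<close> lie in the ball, so \<phi> is controlled on
      their difference.\<close>
    define z where "z = (r / (2 * norm x)) *\<^sub>R x"
    have "norm z < r"
      using r False by (simp add: z_def)
    then have "a + z \<in> E n" "a \<in> E n"
      using r by (auto simp: dist_norm subset_iff)
    then have "norm (\<phi> (a + z)) \<le> real n * k" "norm (\<phi> a) \<le> real n * k"
      using that by (auto simp: E_def)
    moreover have "\<phi> z = \<phi> (a + z) - \<phi> a"
      by (simp add: add)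
    ultimately have "norm (\<phi> z) \<le> 2 * real n * k"
      using norm_triangle_ineq4[of "\<phi> (a + z)" "\<phi> a"] by simp
    moreover have "norm (\<phi> z) = r / (2 * norm x) * norm (\<phi> x)"
      using r by (simp add: z_def scaleR)
    ultimately have "norm (\<phi> x) \<le> 4 * real n / r * k * norm x"
      using r False by (simp add: field_simps)
    also have "\<dots> \<le> C * k * norm x"
      using that(2) by (intro mult_right_mono) (auto simp: C_def dom_def)
    finally show ?thesis .
  qed
  have "1 / C * onorm \<phi> \<le> (SUP l\<in>\<Lambda>. onorm_on (X l) \<phi>)" if \<phi>: "\<phi> \<in> D" for \<phi>
  proof -
    interpret bounded_linear \<phi> using lin \<phi> .
    have bdd: "bdd_above ((\<lambda>x. norm (\<phi> x) / norm x) ` S)" for S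
      by (rule bdd_aboveI2[where M = "onorm \<phi>"]) (rule le_onorm[OF bounded_linear_axioms])
    have on: "norm (\<phi> x) / norm x \<le> onorm_on (X l) \<phi>" if "x \<in> X l" for x l
      unfolding onorm_on_def using bdd that by (rule cSUP_upper2) simp
    have "onorm_on (X l) \<phi> \<le> onorm \<phi>" if "l \<in> \<Lambda>" for l
      unfolding onorm_on_def
      by (rule cSUP_least) (use subspace_0[OF bspec[OF sub that]] le_onorm[OF bounded_linear_axioms] in auto)
    then have "bdd_above ((\<lambda>l. onorm_on (X l) \<phi>) ` \<Lambda>)"
      by (rule bdd_aboveI2)
    then have up: "onorm_on (X l) \<phi> \<le> (SUP l\<in>\<Lambda>. onorm_on (X l) \<phi>)" if "l \<in> \<Lambda>" for l
      using that by (rule cSUP_upper2) simp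
    have "dom \<phi> (SUP l\<in>\<Lambda>. onorm_on (X l) \<phi>)"
      unfolding dom_def
    proof (intro conjI ballI)
      \<comment> \<open>The point \<open>0\<close> of any member contributes
        \<open>0 / 0 = 0\<close>, which forces the supremum to be nonnegative.\<close>
      obtain l where l: "l \<in> \<Lambda>" using ne by blast
      show "0 \<le> (SUP l\<in>\<Lambda>. onorm_on (X l) \<phi>)"
        using on[OF subspace_0[OF bspec[OF sub l]]] up[OF l] by simp
    next
      fix l x assume "l \<in> \<Lambda>" "x \<in> X l"
      then have "norm (\<phi> x) / norm x \<le> (SUP l\<in>\<Lambda>. onorm_on (X l) \<phi>)"
        using on up order_trans by blast
      then show "norm (\<phi> x) \<le> (SUP l\<in>\<Lambda>. onorm_on (X l) \<phi>) * norm x"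
        by (cases "x = 0") (simp_all add: zero field_simps)
    qed
    then have "onorm \<phi> \<le> C * (SUP l\<in>\<Lambda>. onorm_on (X l) \<phi>)"
      using bound[OF \<phi>] C by (intro onorm_bound) (auto simp: dom_def)
    with C show ?thesis
      by (simp add: field_simps)
  qed
  with C show ?thesis
    by (intro exI[of _ "1 / C"]) simp
qed

section \<open>Norming families are representing\<close>

text \<open>The iteration known from the open mapping theorem: each step halves the remainder, so
  the costs of the successive corrections are dominated by a geometric series.\<close>

lemma absolutely_representing_if_approximating:
  fixes X :: "'i \<Rightarrow> 'a::banach set"
  assumes closed: "\<And>l. l \<in> \<Lambda> \<Longrightarrow> closed (X l)" and sub: "\<forall>l\<in>\<Lambda>. subspace (X l)"
    and approx: "\<And>x. \<exists>u c. representable \<Lambda> X u c \<and> norm (x - u) \<le> norm x / 2 \<and> c \<le> M * norm x"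
  shows "absolutely_representing \<Lambda> X"
  unfolding absolutely_representing_iff_representable
proof
  fix x
  obtain u c where uc: "\<And>x. representable \<Lambda> X (u x) (c x)"
      "\<And>x. norm (x - u x) \<le> norm x / 2" "\<And>x. c x \<le> M * norm x"
    using approx by metis
  define r where "r n = ((\<lambda>x. x - u x) ^^ n) x" for n
  have r_Suc: "r (Suc n) = r n - u (r n)" for n
    by (simp add: r_def)
  have r_bound: "norm (r n) \<le> norm x * (1/2) ^ n" for n
  proof (induction n)
    case 0
    show ?case by (simp add: r_def)
  next
    case (Suc n)
    then show ?case using uc(2)[of "r n"] by (simp add: r_Suc)
  qed
  have "r \<longlonglongrightarrow> 0"
  proof (rule tendsto_0_le[where K = 1])
    show "(\<lambda>n. norm x * (1/2) ^ n) \<longlonglongrightarrow> 0"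
      by (intro tendsto_mult_right_zero LIMSEQ_power_zero) simp
  qed (use r_bound in simp)
  \<comment> \<open>Each correction \<open>u (r n)\<close> is the difference of consecutive
    remainders, so the series telescopes to \<open>r 0 = x\<close>.\<close>
  then have "(\<lambda>n. r n - r (Suc n)) sums (r 0 - 0)"
    by (rule telescope_sums')
  then have "(\<lambda>n. u (r n)) sums x"
    by (simp add: r_Suc) (simp add: r_def)
  moreover have "summable (\<lambda>n. c (r n))"
  proof (rule summable_comparison_test')
    show "summable (\<lambda>n. \<bar>M\<bar> * (norm x * (1/2) ^ n))"
      by (intro summable_mult summable_geometric) simp
    fix n
    have "c (r n) \<le> \<bar>M\<bar> * norm (r n)"
      using uc(3)[of "r n"] by (meson abs_ge_self mult_right_mono norm_ge_zero order_trans)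
    also have "\<dots> \<le> \<bar>M\<bar> * (norm x * (1/2) ^ n)"
      using r_bound by (intro mult_left_mono) auto
    finally show "norm (c (r n)) \<le> \<bar>M\<bar> * (norm x * (1/2) ^ n)"
      using representable_nonneg[OF uc(1)[of "r n"]] by simp
  qed
  ultimately show "\<exists>c. representable \<Lambda> X x c"
    using representable_sums[OF sub closed uc(1)] by blast
qed

text \<open>The hypothesis \<open>majorant\<close> isolates the dependence on the scalars: it turns
  the real functional delivered by Hahn--Banach into an element of \<open>D\<close> with the same
  bounds.\<close>

lemma absolutely_representing_if_norming:
  fixes X :: "'i \<Rightarrow> 'a::banach set" and D :: "('a \<Rightarrow> 'b::real_normed_vector) set"
  assumes ne: "\<Lambda> \<noteq> {}" and closed: "\<And>l. l \<in> \<Lambda> \<Longrightarrow> closed (X l)"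
    and sub: "\<forall>l\<in>\<Lambda>. subspace (X l)"
    and majorant: "\<And>f K. \<lbrakk>linear f; \<And>x. f x \<le> K * norm x; \<And>l x. l \<in> \<Lambda> \<Longrightarrow> x \<in> X l \<Longrightarrow> f x \<le> norm x\<rbrakk>
      \<Longrightarrow> \<exists>\<phi>\<in>D. (\<forall>x. f x \<le> norm (\<phi> x) \<and> norm (\<phi> x) \<le> K * norm x) \<and>
             (\<forall>l\<in>\<Lambda>. \<forall>x\<in>X l. norm (\<phi> x) \<le> norm x)"
    and "\<epsilon> > 0" and norming: "\<And>\<phi>. \<phi> \<in> D \<Longrightarrow> (SUP l\<in>\<Lambda>. onorm_on (X l) \<phi>) \<ge> \<epsilon> * onorm \<phi>"
  shows "absolutely_representing \<Lambda> X"
proof (rule absolutely_representing_if_approximating[where M = "2 / \<epsilon>", OF closed sub])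
  fix x :: 'a
  \<comment> \<open>Chosen so that \<open>K * norm (x - u) \<le> 2 * norm x / \<epsilon>\<close>
    means \<open>norm (x - u) \<le> norm x / 2\<close>.\<close>
  define K where "K = 4 / \<epsilon>"
  have K: "K > 0" using \<open>\<epsilon> > 0\<close> by (simp add: K_def)
  let ?R = "{(u, c). representable \<Lambda> X u c}"
  \<comment> \<open>The penalty \<open>K * norm (x - u)\<close> lets every pair compete, whether or
    not \<open>x\<close> has a representation; the pair \<open>(0, 0)\<close> alone gives
    \<open>p x \<le> K * norm x\<close>.\<close>
  define p where "p x = (INF (u, c)\<in>?R. c + K * norm (x - u))" for x
  have ne_R: "?R \<noteq> {}"
    using representable_zero[OF sub] by blast
  have bdd: "bdd_below ((\<lambda>(u, c). c + K * norm (x - u)) ` ?R)" for x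
    by (rule bdd_belowI2[where m = 0]) (use representable_nonneg K in force)
  have low: "p x \<le> c + K * norm (x - u)" if "representable \<Lambda> X u c" for x u c
    unfolding p_def using cINF_lower[OF bdd, of "(u, c)" x] that by simp
  have great: "d \<le> p x" if "\<And>u c. representable \<Lambda> X u c \<Longrightarrow> d \<le> c + K * norm (x - u)" for d x
    unfolding p_def by (rule cINF_greatest[OF ne_R]) (use that in auto)
  have "sublinear p"
  proof (rule sublinearI)
    fix x y
    have "p (x + y) - (c + K * norm (x - u)) \<le> p y" if uc: "representable \<Lambda> X u c" for u c
    proof (rule great)
      fix v d assume vd: "representable \<Lambda> X v d"
      have "p (x + y) \<le> c + d + K * norm (x + y - (u + v))"
        using low representable_add[OF sub uc vd] by blast
      also have "\<dots> \<le> c + d + K * (norm (x - u) + norm (y - v))"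
        using K norm_diff_triangle_ineq[of x y u v] by simp
      finally show "p (x + y) - (c + K * norm (x - u)) \<le> d + K * norm (y - v)"
        by (simp add: algebra_simps)
    qed
    then have "p (x + y) - p y \<le> p x"
      by (intro great) (simp add: algebra_simps)
    then show "p (x + y) \<le> p x + p y" by simp
  next
    fix t :: real and x assume t: "t > 0"
    have "p (t *\<^sub>R x) / t \<le> p x"
    proof (rule great)
      fix u c assume uc: "representable \<Lambda> X u c"
      have "p (t *\<^sub>R x) \<le> t * c + K * norm (t *\<^sub>R x - t *\<^sub>R u)"
        using low representable_scale[OF sub uc] t by simp
      also have "\<dots> = t * (c + K * norm (x - u))"
        using norm_scaleR[of t "x - u"] t by (simp add: scaleR_diff_right distrib_left)
      finally show "p (t *\<^sub>R x) / t \<le> c + K * norm (x - u)"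
        using t by (simp add: field_simps)
    qed
    with t show "p (t *\<^sub>R x) \<le> t * p x" by (simp add: field_simps)
  next
    show "0 \<le> p 0"
      by (rule great) (use representable_nonneg K in force)
  qed
  \<comment> \<open>\<open>f\<close> touches \<open>p\<close> at the given \<open>x\<close>, so a
    bound on \<open>f x\<close> is a bound on \<open>p x\<close>. The choices \<open>u = 0\<close>
    and \<open>u = y\<close> in the infimum then give the two bounds required by
    \<open>majorant\<close>.\<close>
  then obtain f where f: "linear f" "f \<le> p" "f x = p x"
    by (rule Hahn_Banach_sublinear)
  have "f y \<le> K * norm y" for y
    using le_funD[OF f(2), of y] low[OF representable_zero[OF sub], of y] by simp
  moreover have "f y \<le> norm y" if "l \<in> \<Lambda>" "y \<in> X l" for l y
    using le_funD[OF f(2), of y] low[OF representable_member[OF sub that], of y] by simp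
  ultimately obtain \<phi> where \<phi>: "\<phi> \<in> D" "\<And>x. f x \<le> norm (\<phi> x)" "\<And>x. norm (\<phi> x) \<le> K * norm x"
      "\<And>l x. l \<in> \<Lambda> \<Longrightarrow> x \<in> X l \<Longrightarrow> norm (\<phi> x) \<le> norm x"
    using majorant[OF f(1)] by metis
  have "onorm_on (X l) \<phi> \<le> 1" if "l \<in> \<Lambda>" for l
    unfolding onorm_on_def
    by (rule cSUP_least) (use \<phi>(4)[OF that] subspace_0[OF bspec[OF sub that]] in \<open>auto simp: divide_le_eq_1\<close>)
  then have "(SUP l\<in>\<Lambda>. onorm_on (X l) \<phi>) \<le> 1"
    using ne by (intro cSUP_least)
  with norming[OF \<phi>(1)] have "\<epsilon> * onorm \<phi> \<le> 1" by simp
  moreover have "norm (\<phi> x) / norm x \<le> onorm \<phi>"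
    unfolding onorm_def
  proof (rule cSUP_upper)
    \<comment> \<open>The bound by \<open>K\<close> makes the quotients bounded, so that their
      supremum dominates each of them.\<close>
    show "bdd_above (range (\<lambda>x. norm (\<phi> x) / norm x))"
      by (rule bdd_aboveI2[where M = K]) (use \<phi>(3) K in \<open>simp add: divide_le_eq\<close>)
  qed simp
  ultimately have "\<epsilon> * (norm (\<phi> x) / norm x) \<le> 1"
    using \<open>\<epsilon> > 0\<close> by (meson mult_left_mono less_imp_le order_trans)
  then have px: "p x \<le> norm x / \<epsilon>" if "x \<noteq> 0"
  proof -
    have "norm (\<phi> x) \<le> norm x / \<epsilon>"
      using \<open>\<epsilon> * (norm (\<phi> x) / norm x) \<le> 1\<close> \<open>\<epsilon> > 0\<close> that by (simp add: field_simps)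
    with \<phi>(2)[of x] f(3) show ?thesis by simp
  qed
  show "\<exists>u c. representable \<Lambda> X u c \<and> norm (x - u) \<le> norm x / 2 \<and> c \<le> 2 / \<epsilon> * norm x"
  proof (cases "x = 0")
    case True
    then show ?thesis using representable_zero[OF sub] by force
  next
    case False
    \<comment> \<open>The infimum need not be attained; the strict gap, available as
      \<open>x \<noteq> 0\<close>, provides a pair whose cost is below the larger value.\<close>
    have "norm x / \<epsilon> < 2 * norm x / \<epsilon>"
      using False \<open>\<epsilon> > 0\<close> by (simp add: divide_strict_right_mono)
    with px[OF False] have "p x < 2 * norm x / \<epsilon>" by simp
    then obtain u c where uc: "representable \<Lambda> X u c" "c + K * norm (x - u) < 2 * norm x / \<epsilon>"
      using great[of "2 * norm x / \<epsilon>" x] by (meson not_le)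
    have "0 \<le> c" "0 \<le> K * norm (x - u)"
      using representable_nonneg[OF uc(1)] K by auto
    with uc(2) have "c \<le> 2 / \<epsilon> * norm x" "K * norm (x - u) \<le> 2 * norm x / \<epsilon>"
      by auto
    with uc(1) \<open>\<epsilon> > 0\<close> show ?thesis
      by (intro exI[of _ u] exI[of _ c]) (simp add: K_def field_simps)
  qed
qed

section \<open>Real and complex scalars\<close>

text \<open>Continuity at \<open>0\<close> bounds \<open>f\<close> by \<open>1\<close> on a ball of
  radius \<open>d\<close>; rescaling \<open>x\<close> to norm \<open>d / 2\<close> gives the
  constant \<open>2 / d\<close>.\<close>

lemma bounded_linear_if_continuous:
  fixes f :: "'a::real_normed_vector \<Rightarrow> 'b::real_normed_vector"
  assumes f: "linear f" and cont: "continuous_on UNIV f"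
  shows "bounded_linear f"
proof -
  interpret linear f by fact
  obtain d where d: "d > 0" "\<And>x. norm x < d \<Longrightarrow> norm (f x) < 1"
    using cont[unfolded continuous_on_iff, rule_format, of 0 1] by (auto simp: dist_norm zero)
  have "norm (f x) \<le> norm x * (2 / d)" for x
  proof (cases "x = 0")
    case False
    have "norm (f ((d / (2 * norm x)) *\<^sub>R x)) < 1"
      using d(1) False by (intro d(2)) simp
    then show ?thesis
      using d(1) False by (simp add: scale field_simps)
  qed (simp add: zero)
  with f show ?thesis
    by (intro bounded_linear.intro bounded_linear_axioms.intro exI allI)
qed

lemma (in banach_space_over) linear_imp_real_linear:
  assumes "Vector_Spaces.linear scale (*) \<phi>"
  shows "linear \<phi>"
proof (rule linearI)
  interpret \<phi>: Vector_Spaces.linear scale "(*)" \<phi> by fact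
  show "\<phi> (x + y) = \<phi> x + \<phi> y" for x y
    by (rule \<phi>.add)
  show "\<phi> (r *\<^sub>R x) = r *\<^sub>R \<phi> x" for r x
    using \<phi>.scale[of "of_real r" x] by (simp add: scale_of_real scaleR_conv_of_real)
qed

lemma (in banach_space_over) bounded_linear_dual_space:
  "\<phi> \<in> dual_space scale \<Longrightarrow> bounded_linear \<phi>"
  by (simp add: dual_space_def bounded_linear_if_continuous linear_imp_real_linear)

lemma (in banach_space_over) subspace_imp_real_subspace:
  "subspace S \<Longrightarrow> real_vector.subspace S"
  by (metis real_vector.subspace_def scale_of_real subspace_def)

lemma abs_le_if_linear_le:
  fixes f :: "'a::real_vector \<Rightarrow> real"
  assumes "linear f" "f x \<le> c" "f (- x) \<le> c"
  shows "\<bar>f x\<bar> \<le> c"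
  using assms linear_neg[of f x] by auto

lemma linear_le_norm_in_dual_space:
  fixes f :: "'a::banach \<Rightarrow> real"
  assumes f: "linear f" and le: "\<And>x. f x \<le> K * norm x"
  shows "f \<in> dual_space scaleR"
proof -
  have "\<bar>f x\<bar> \<le> norm x * K" for x
    using abs_le_if_linear_le[OF f le[of x]] le[of "- x"] by (simp add: mult.commute)
  then have "bounded_linear f"
    using f by (intro bounded_linear.intro bounded_linear_axioms.intro) auto
  moreover have "Vector_Spaces.linear scaleR (*) f"
    using f by (simp add: linear_def real_scaleR_def[abs_def])
  ultimately show ?thesis
    by (simp add: dual_space_def linear_continuous_on)
qed

text \<open>The classical formula \<open>f x - \<i> * f (\<i> x)\<close> for the complex-linear
  functional with real part \<open>f\<close>.\<close>

definition complexified :: "(complex \<Rightarrow> 'a \<Rightarrow> 'a) \<Rightarrow> ('a \<Rightarrow> real) \<Rightarrow> 'a \<Rightarrow> complex" where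
  "complexified sc f x = Complex (f x) (- f (sc \<i> x))"

lemma complexified_linear:
  fixes sc :: "complex \<Rightarrow> 'a::banach \<Rightarrow> 'a"
  assumes "banach_space_over sc" and f: "linear f"
  shows "Vector_Spaces.linear sc (*) (complexified sc f)"
proof -
  interpret banach_space_over sc by fact
  have scale_complex: "f (sc c x) = Re c * f x + Im c * f (sc \<i> x)" for c x
  proof -
    have "sc c x = sc (of_real (Re c)) x + sc (of_real (Im c)) (sc \<i> x)"
      by (subst complex_eq[of c]) (simp add: scale_left_distrib mult.commute)
    then show ?thesis
      by (simp add: scale_of_real linear_add[OF f] linear_scale[OF f] del: scale_scale)
  qed
  have "complexified sc f (sc c x) = c * complexified sc f x" for c x
    \<comment> \<open>The instance at \<open>c\<close> settles the real parts, the instance at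
      \<open>\<i> * c\<close> the imaginary parts.\<close>
    using scale_complex[of c x] scale_complex[of "\<i> * c" x]
    by (simp add: complexified_def complex_eq_iff algebra_simps)
  moreover have "complexified sc f (x + y) = complexified sc f x + complexified sc f y" for x y
    by (simp add: complexified_def complex_eq_iff linear_add[OF f] scale_right_distrib)
  moreover have "vector_space ((*) :: complex \<Rightarrow> complex \<Rightarrow> complex)"
    by unfold_locales (auto simp: algebra_simps)
  ultimately show ?thesis
    using vector_space_axioms by (simp add: Vector_Spaces.linear_iff)
qed

text \<open>Multiplying \<open>x\<close> by a scalar of modulus \<open>1\<close> makes the value
  real and nonnegative, hence equal to \<open>f\<close> at the rotated point. That point is still in
  \<open>S\<close> and has the same norm, so the one-sided bound on \<open>f\<close>
  suffices.\<close>

lemma norm_complexified_le: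
  fixes sc :: "complex \<Rightarrow> 'a::banach \<Rightarrow> 'a"
  assumes B: "banach_space_over sc" and f: "linear f" and S: "module.subspace sc S"
    and le: "\<And>x. x \<in> S \<Longrightarrow> f x \<le> K * norm x" and x: "x \<in> S"
  shows "norm (complexified sc f x) \<le> K * norm x"
proof -
  interpret banach_space_over sc by fact
  interpret \<phi>: Vector_Spaces.linear sc "(*)" "complexified sc f"
    using B f by (rule complexified_linear)
  let ?z = "complexified sc f x"
  have mem: "sc c x \<in> S" for c
    using subspace_scale[OF S x] .
  show ?thesis
  proof (cases "?z = 0")
    case True
    \<comment> \<open>The sign of \<open>K\<close> is not given; nonnegativity of
      \<open>K * norm x\<close> is read off from the bounds at \<open>x\<close> and
      \<open>- x\<close>.\<close>
    have "\<bar>f x\<bar> \<le> K * norm x"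
      using abs_le_if_linear_le[OF f le[OF x]] le[OF mem[of "- 1"]] by simp
    with True show ?thesis by simp
  next
    case False
    let ?c = "cnj ?z / of_real (norm ?z)"
    have "complexified sc f (sc ?c x) = ?c * ?z"
      by (rule \<phi>.scale)
    also have "\<dots> = of_real (norm ?z)"
      using False complex_norm_square[of ?z]
      by (simp add: field_simps power2_eq_square)
    finally have "f (sc ?c x) = norm ?z"
      by (simp add: complexified_def complex_eq_iff)
    then show ?thesis
      using le[OF mem[of ?c]] False by (simp add: norm_scale norm_divide)
  qed
qed

lemma complexified_in_dual_space:
  fixes sc :: "complex \<Rightarrow> 'a::banach \<Rightarrow> 'a"
  assumes B: "banach_space_over sc" and f: "linear f" and le: "\<And>x. f x \<le> K * norm x"
  shows "complexified sc f \<in> dual_space sc"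
proof -
  interpret banach_space_over sc by fact
  have lin: "Vector_Spaces.linear sc (*) (complexified sc f)"
    using B f by (rule complexified_linear)
  have "norm (complexified sc f x) \<le> norm x * K" for x
    using norm_complexified_le[OF B f subspace_UNIV le, of x] by (simp add: mult.commute)
  then have "bounded_linear (complexified sc f)"
    using linear_imp_real_linear[OF lin]
    by (intro bounded_linear.intro bounded_linear_axioms.intro) auto
  with lin show ?thesis
    by (simp add: dual_space_def linear_continuous_on)
qed

text \<open>Joins the two directions for an arbitrary scalar field, leaving \<open>majorant\<close>
  to be checked for the reals and the complex numbers separately.\<close>

lemma (in banach_space_over) absolutely_representing_iff_norming:
  fixes X :: "'i \<Rightarrow> 'a set"
  assumes "\<Lambda> \<noteq> {}" and "\<And>l. l \<in> \<Lambda> \<Longrightarrow> closed (X l)" and "\<forall>l\<in>\<Lambda>. subspace (X l)"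
    and majorant: "\<And>f K. \<lbrakk>linear f; \<And>x. f x \<le> K * norm x;
        \<And>l x. l \<in> \<Lambda> \<Longrightarrow> x \<in> X l \<Longrightarrow> f x \<le> norm x\<rbrakk>
      \<Longrightarrow> \<exists>\<phi>\<in>dual_space scale. (\<forall>x. f x \<le> norm (\<phi> x) \<and> norm (\<phi> x) \<le> K * norm x) \<and>
             (\<forall>l\<in>\<Lambda>. \<forall>x\<in>X l. norm (\<phi> x) \<le> norm x)"
  shows "absolutely_representing \<Lambda> X \<longleftrightarrow>
    (\<exists>\<epsilon>>0. \<forall>\<phi>\<in>dual_space scale. (SUP l\<in>\<Lambda>. onorm_on (X l) \<phi>) \<ge> \<epsilon> * onorm \<phi>)"
proof -
  have sub: "\<forall>l\<in>\<Lambda>. real_vector.subspace (X l)"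
    using assms(3) subspace_imp_real_subspace by blast
  show ?thesis
    using norming_if_absolutely_representing[OF assms(1) bounded_linear_dual_space sub]
      absolutely_representing_if_norming[OF assms(1,2) sub majorant]
    by blast
qed

theorem theorem4p1:
  fixes \<Lambda> :: "'i set" and X :: "'i \<Rightarrow> 'a::banach set"
  assumes "\<Lambda> \<noteq> {}"
    and "\<And>l. l \<in> \<Lambda> \<Longrightarrow> closed (X l)"
  shows "((\<forall>l\<in>\<Lambda>. subspace (X l)) \<longrightarrow>
            (absolutely_representing \<Lambda> X \<longleftrightarrow>
              (\<exists>\<epsilon>>0. \<forall>\<phi> \<in> dual_space (scaleR :: real \<Rightarrow> 'a \<Rightarrow> 'a).
                 (SUP l\<in>\<Lambda>. onorm_on (X l) \<phi>) \<ge> \<epsilon> * onorm \<phi>))) \<and>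
         (\<forall>sc :: complex \<Rightarrow> 'a \<Rightarrow> 'a. banach_space_over sc \<longrightarrow>
            (\<forall>l\<in>\<Lambda>. module.subspace sc (X l)) \<longrightarrow>
            (absolutely_representing \<Lambda> X \<longleftrightarrow>
              (\<exists>\<epsilon>>0. \<forall>\<phi> \<in> dual_space sc.
                 (SUP l\<in>\<Lambda>. onorm_on (X l) \<phi>) \<ge> \<epsilon> * onorm \<phi>)))"
proof (intro conjI impI allI)
  assume sub: "\<forall>l\<in>\<Lambda>. subspace (X l)"
  interpret banach_space_over "scaleR :: real \<Rightarrow> 'a \<Rightarrow> 'a"
    by (rule banach_space_over_scaleR)
  show "absolutely_representing \<Lambda> X \<longleftrightarrow> (\<exists>\<epsilon>>0. \<forall>\<phi>\<in>dual_space (scaleR :: real \<Rightarrow> 'a \<Rightarrow> 'a).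
      (SUP l\<in>\<Lambda>. onorm_on (X l) \<phi>) \<ge> \<epsilon> * onorm \<phi>)"
  proof (rule absolutely_representing_iff_norming[OF assms sub[unfolded subspace_raw_def]])
    fix f :: "'a \<Rightarrow> real" and K
    assume f: "linear f" and K: "\<And>x. f x \<le> K * norm x"
      and X: "\<And>l x. l \<in> \<Lambda> \<Longrightarrow> x \<in> X l \<Longrightarrow> f x \<le> norm x"
    show "\<exists>\<phi>\<in>dual_space scaleR. (\<forall>x. f x \<le> norm (\<phi> x) \<and> norm (\<phi> x) \<le> K * norm x) \<and>
        (\<forall>l\<in>\<Lambda>. \<forall>x\<in>X l. norm (\<phi> x) \<le> norm x)"
    \<comment> \<open>Over the reals \<open>f\<close> is its own majorant: members are closed under
      negation, so the one-sided bounds are bounds on the absolute value.\<close>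
    proof (intro bexI[of _ f] conjI allI ballI)
      show "f \<in> dual_space scaleR" using f K by (rule linear_le_norm_in_dual_space)
      show "norm (f x) \<le> K * norm x" for x
        using abs_le_if_linear_le[OF f K[of x]] K[of "- x"] by simp
      show "norm (f x) \<le> norm x" if "l \<in> \<Lambda>" "x \<in> X l" for l x
        using abs_le_if_linear_le[OF f X[OF that]] X[of l "- x"] that sub
        by (simp add: real_vector.subspace_neg)
    qed simp
  qed
next
  fix sc :: "complex \<Rightarrow> 'a \<Rightarrow> 'a"
  assume B: "banach_space_over sc" and sub: "\<forall>l\<in>\<Lambda>. module.subspace sc (X l)"
  interpret banach_space_over sc by fact
  show "absolutely_representing \<Lambda> X \<longleftrightarrow>
      (\<exists>\<epsilon>>0. \<forall>\<phi>\<in>dual_space sc. (SUP l\<in>\<Lambda>. onorm_on (X l) \<phi>) \<ge> \<epsilon> * onorm \<phi>)"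
  proof (rule absolutely_representing_iff_norming[OF assms sub])
    fix f :: "'a \<Rightarrow> real" and K
    assume f: "linear f" and K: "\<And>x. f x \<le> K * norm x"
      and X: "\<And>l x. l \<in> \<Lambda> \<Longrightarrow> x \<in> X l \<Longrightarrow> f x \<le> norm x"
    show "\<exists>\<phi>\<in>dual_space sc. (\<forall>x. f x \<le> norm (\<phi> x) \<and> norm (\<phi> x) \<le> K * norm x) \<and>
        (\<forall>l\<in>\<Lambda>. \<forall>x\<in>X l. norm (\<phi> x) \<le> norm x)"
    \<comment> \<open>Over the complex numbers the complexification dominates \<open>f\<close>,
      which is its real part, and inherits the bounds on the whole space and, with constant
      \<open>1\<close>, on each member.\<close>
    proof (intro bexI[of _ "complexified sc f"] conjI allI ballI)
      show "complexified sc f \<in> dual_space sc" using B f K by (rule complexified_in_dual_space)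
      show "f x \<le> norm (complexified sc f x)" for x
        using complex_Re_le_cmod[of "complexified sc f x"] by (simp add: complexified_def)
      show "norm (complexified sc f x) \<le> K * norm x" for x
        using norm_complexified_le[OF B f subspace_UNIV K] by simp
      show "norm (complexified sc f x) \<le> norm x" if "l \<in> \<Lambda>" "x \<in> X l" for l x
        using norm_complexified_le[OF B f, of "X l" 1 x] sub that X by simp
    qed
  qed
qed

end
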